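(* Let $L\in H_2(\mathbb{P}^3,\mathbb{Z})$ be the class of a line. Let $$Z(q)=\frac{-2q-q^2+31q^3-31q^4+q^5+2q^6}{18(1+q)^3}$$ be Pandharipande's exact series for $Z_P(\mathbb{P}^3;q\mid\tau_5(1))_L=\sum_{n\in\mathbb{Z}}\langle\tau_5(1)\rangle^{PT}_{n,L}q^n$, and let $$Z^{\ge4}(q)=\sum_{n\ge4}\langle\tau_5(1)\rangle^{PT}_{n,L}q^n=-\frac{5q^4(2q^2+7q+11)}{9(1+q)^3}$$ be the large-$n$ tail. Then $$Z(q)-Z^{\ge4}(q)=\frac{q(22q^2+5q-2)}{18},$$ which is a Laurent polynomial.
   Context: $P_n(X,\beta)$ is the moduli space of Pandharipande--Thomas stable pairs $(F,s)$ on $X$ ($F$ pure one-dimensional with support class $\beta$ and $\chi(F)=n$, $s:\mathcal{O}_X\to F$ with zero-dimensional cokernel), with its Pandharipande--Thomas virtual class. With $\mathbb{F}$ the universal sheaf on $X\times P_n(X,\beta)$, $\tau_k(\gamma)=\pi_{P*}(\pi_X^*(\gamma)\cdot\mathrm{ch}_{2+k}(\mathbb{F}))$ and $\langle\tau_k(\gamma)\rangle^{PT}_{n,\beta}=\int_{[P_n(X,\beta)]^{\mathrm{vir}}}\tau_k(\gamma)$. The closed formula for $Z(q)$ is a known result of Pandharipande obtained by localization and may be taken as given. *)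

theory Defs
  imports "HOL-Algebra.Ring" "HOL-Computational_Algebra.Formal_Laurent_Series"
begin

text \<open>
  No library here has schemes, moduli of sheaves or virtual classes.  A moduli space
  \<open>P = P_n(X,\<beta>)\<close> of stable pairs is therefore represented by the rational-cohomological
  data from which its descendent invariants are formed:

  \<^item> \<open>coh_P\<close>: the ring \<open>H^*(P, Q)\<close>;
  \<^item> \<open>coh_XP\<close>: the ring \<open>H^*(X \<times> P, Q)\<close>;
  \<^item> \<open>pull_X\<close>: the pullback \<open>\<pi>_X^*\<close> along \<open>X \<times> P \<rightarrow> X\<close>;
  \<^item> \<open>univ_ch k\<close>: the component \<open>ch_k\<close> of the Chern character of the universal sheaf on \<open>X \<times> P\<close>;
  \<^item> \<open>push_P\<close>: the pushforward \<open>\<pi>_{P*}\<close> along \<open>X \<times> P \<rightarrow> P\<close>;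
  \<^item> \<open>vir_int\<close>: integration against the virtual class.
\<close>

record ('x, 'u, 'p) pairs_space =
  coh_P :: "'p ring"
  coh_XP :: "'u ring"
  pull_X :: "'x \<Rightarrow> 'u"
  univ_ch :: "nat \<Rightarrow> 'u"
  push_P :: "'u \<Rightarrow> 'p"
  vir_int :: "'p \<Rightarrow> rat"

text \<open>
  \<open>HX\<close> is \<open>H^*(X, Q)\<close>, and \<open>M n \<beta>\<close> is the data of \<open>P_n(X,\<beta>)\<close>, with \<open>\<beta>\<close> in a type \<open>'c\<close> of
  curve classes.  The rings are not required to be commutative, since cohomology is only
  graded-commutative.  The last axiom says that \<open>P_n(X,\<beta>)\<close> is empty (cohomology ring zero)
  for \<open>n\<close> sufficiently negative; this is what makes the generating series Laurent series.
\<close>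

locale stable_pairs_theory =
  fixes HX :: "'x ring" and M :: "int \<Rightarrow> 'c \<Rightarrow> ('x, 'u, 'p) pairs_space"
  assumes ring_HX: "ring HX"
    and ring_P: "ring (coh_P (M n \<beta>))"
    and ring_XP: "ring (coh_XP (M n \<beta>))"
    and pull_hom: "pull_X (M n \<beta>) \<in> ring_hom HX (coh_XP (M n \<beta>))"
    and ch_closed: "univ_ch (M n \<beta>) k \<in> carrier (coh_XP (M n \<beta>))"
    and push_hom:
      "push_P (M n \<beta>) \<in> hom (add_monoid (coh_XP (M n \<beta>))) (add_monoid (coh_P (M n \<beta>)))"
    and vir_int_add:
      "\<lbrakk>x \<in> carrier (coh_P (M n \<beta>)); y \<in> carrier (coh_P (M n \<beta>))\<rbrakk> \<Longrightarrow>
        vir_int (M n \<beta>) (x \<oplus>\<^bsub>coh_P (M n \<beta>)\<^esub> y) = vir_int (M n \<beta>) x + vir_int (M n \<beta>) y"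
    and eventually_empty:
      "\<exists>N. \<forall>n < N. carrier (coh_P (M n \<beta>)) = {\<zero>\<^bsub>coh_P (M n \<beta>)\<^esub>}"

definition descendent :: "('x, 'u, 'p) pairs_space \<Rightarrow> nat \<Rightarrow> 'x \<Rightarrow> 'p" where
  "descendent P k \<gamma> = push_P P (pull_X P \<gamma> \<otimes>\<^bsub>coh_XP P\<^esub> univ_ch P (2 + k))"

definition PT_invariant :: "('x, 'u, 'p) pairs_space \<Rightarrow> nat \<Rightarrow> 'x \<Rightarrow> rat" where
  "PT_invariant P k \<gamma> = vir_int P (descendent P k \<gamma>)"

definition PT_series ::
    "(int \<Rightarrow> 'c \<Rightarrow> ('x, 'u, 'p) pairs_space) \<Rightarrow> nat \<Rightarrow> 'x \<Rightarrow> 'c \<Rightarrow> rat fls" where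
  "PT_series M k \<gamma> \<beta> = Abs_fls (\<lambda>n. PT_invariant (M n \<beta>) k \<gamma>)"

definition PT_series_ge ::
    "int \<Rightarrow> (int \<Rightarrow> 'c \<Rightarrow> ('x, 'u, 'p) pairs_space) \<Rightarrow> nat \<Rightarrow> 'x \<Rightarrow> 'c \<Rightarrow> rat fls" where
  "PT_series_ge m M k \<gamma> \<beta> = Abs_fls (\<lambda>n. if n \<ge> m then PT_invariant (M n \<beta>) k \<gamma> else 0)"

text \<open>
  \<open>H^*(P^3, Q) = Q[H]/(H^4)\<close>, on reduced representatives; the polynomial variable is the
  hyperplane class \<open>H\<close>.
\<close>

definition coh_P3 :: "rat poly ring" where
  "coh_P3 = \<lparr>carrier = {p. degree p < 4}, monoid.mult = (\<lambda>p r. (p * r) mod monom 1 4), monoid.one = 1,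
             ring.zero = 0, ring.add = (+)\<rparr>"

lemma cring_coh_P3: "cring coh_P3"
proof -
  let ?m = "monom 1 4 :: rat poly"
  have deg: "degree ?m = 4" by (simp add: degree_monom_eq)
  have nz: "?m \<noteq> 0" by (simp add: monom_eq_0_iff)
  have cl: "degree (p mod ?m) < 4" for p :: "rat poly"
    using degree_mod_less[OF nz, of p] deg by auto
  have red: "p mod ?m = p" if "degree p < 4" for p :: "rat poly"
    using that deg by (simp add: mod_poly_less)
  have "abelian_group coh_P3"
  proof (rule abelian_groupI)
    fix x assume "x \<in> carrier coh_P3"
    then show "\<exists>y\<in>carrier coh_P3. y \<oplus>\<^bsub>coh_P3\<^esub> x = \<zero>\<^bsub>coh_P3\<^esub>"
      by (intro bexI[of _ "- x"]) (auto simp: coh_P3_def)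
  qed (auto simp: coh_P3_def degree_add_less algebra_simps)
  moreover have "comm_monoid coh_P3"
    by (rule comm_monoidI)
       (auto simp: coh_P3_def cl red mod_mult_left_eq mod_mult_right_eq mult_ac)
  ultimately show ?thesis
    by (rule cringI)
       (auto simp: coh_P3_def distrib_right poly_mod_add_left)
qed

text \<open>
  \<open>H_2(P^3, Z)\<close> is identified with \<open>int\<close> by the degree (pairing with \<open>H\<close>); a line has degree one.
\<close>

definition line_class :: int where
  "line_class = 1"

definition is_Laurent_polynomial :: "'a::zero fls \<Rightarrow> bool" where
  "is_Laurent_polynomial f \<longleftrightarrow> finite {n. fls_nth f n \<noteq> 0}"

end

theory Submission imports Defs begin

text \<open>
  The claimed Laurent polynomial \<open>R\<close> and the claimed tail \<open>T\<close> satisfy \<open>Z = R + T\<close> as rational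
  functions.  Since \<open>R\<close> has no terms of degree at least 4 and \<open>T\<close> is \<open>q\<^sup>4\<close> times a power series,
  this decomposition must be the one obtained by cutting \<open>Z\<close> at degree 4.
\<close>

context stable_pairs_theory
begin

lemma descendent_closed:
  assumes "\<gamma> \<in> carrier HX"
  shows "descendent (M n \<beta>) k \<gamma> \<in> carrier (coh_P (M n \<beta>))"
proof -
  interpret XP: ring "coh_XP (M n \<beta>)"
    by (rule ring_XP)
  have "pull_X (M n \<beta>) \<gamma> \<in> carrier (coh_XP (M n \<beta>))"
    using pull_hom assms by (rule ring_hom_closed)
  then have "pull_X (M n \<beta>) \<gamma> \<otimes>\<^bsub>coh_XP (M n \<beta>)\<^esub> univ_ch (M n \<beta>) (2 + k) \<in> carrier (coh_XP (M n \<beta>))"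
    using ch_closed by (rule XP.m_closed)
  then show ?thesis
    using hom_in_carrier[OF push_hom] by (simp add: descendent_def)
qed

lemma vir_int_zero: "vir_int (M n \<beta>) \<zero>\<^bsub>coh_P (M n \<beta>)\<^esub> = 0"
proof -
  interpret P: ring "coh_P (M n \<beta>)"
    by (rule ring_P)
  show ?thesis
    using vir_int_add[of "\<zero>\<^bsub>coh_P (M n \<beta>)\<^esub>" n \<beta> "\<zero>\<^bsub>coh_P (M n \<beta>)\<^esub>"] by simp
qed

lemma PT_invariant_eventually_zero:
  assumes "\<gamma> \<in> carrier HX"
  obtains N where "\<And>n. n < N \<Longrightarrow> PT_invariant (M n \<beta>) k \<gamma> = 0"
proof -
  obtain N where N: "\<And>n. n < N \<Longrightarrow> carrier (coh_P (M n \<beta>)) = {\<zero>\<^bsub>coh_P (M n \<beta>)\<^esub>}"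
    using eventually_empty by blast
  have "PT_invariant (M n \<beta>) k \<gamma> = 0" if "n < N" for n
    using descendent_closed[OF assms, of n \<beta> k] N[OF that] vir_int_zero
    by (simp add: PT_invariant_def)
  then show thesis
    by (rule that)
qed

lemma fls_nth_PT_series:
  assumes "\<gamma> \<in> carrier HX"
  shows "fls_nth (PT_series M k \<gamma> \<beta>) n = PT_invariant (M n \<beta>) k \<gamma>"
proof -
  obtain N where "\<And>n. n < N \<Longrightarrow> PT_invariant (M n \<beta>) k \<gamma> = 0"
    using PT_invariant_eventually_zero[OF assms] by metis
  then show ?thesis
    unfolding PT_series_def by (subst nth_Abs_fls_lower_bound[of N]) auto
qed

lemma fls_nth_PT_series_ge:
  assumes "\<gamma> \<in> carrier HX"
  shows "fls_nth (PT_series_ge m M k \<gamma> \<beta>) n =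
    (if m \<le> n then fls_nth (PT_series M k \<gamma> \<beta>) n else 0)"
  unfolding PT_series_ge_def fls_nth_PT_series[OF assms]
  by (subst nth_Abs_fls_lower_bound[of m]) auto

lemma PT_series_ge_eqI:
  assumes "\<gamma> \<in> carrier HX"
    and "PT_series M k \<gamma> \<beta> = R + T"
    and "\<And>n. n \<ge> m \<Longrightarrow> fls_nth R n = 0"
    and "\<And>n. n < m \<Longrightarrow> fls_nth T n = 0"
  shows "PT_series_ge m M k \<gamma> \<beta> = T"
  by (rule fls_eqI) (simp add: fls_nth_PT_series_ge assms)

end

lemma line_series_decomposition:
  fixes x :: "'a :: field_char_0"
  assumes "1 + x \<noteq> 0"
  shows "(- 2 * x - x ^ 2 + 31 * x ^ 3 - 31 * x ^ 4 + x ^ 5 + 2 * x ^ 6) / (18 * (1 + x) ^ 3) =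
    x * (22 * x ^ 2 + 5 * x - 2) / 18 +
    - (5 * x ^ 4 * (2 * x ^ 2 + 7 * x + 11) / (9 * (1 + x) ^ 3))"
proof -
  have split: "(a * d - 2 * b) / (18 * d) = a / 18 + - (b / (9 * d))" if "d \<noteq> 0" for a b d :: 'a
    using that by (simp add: field_simps)
  have "- 2 * x - x ^ 2 + 31 * x ^ 3 - 31 * x ^ 4 + x ^ 5 + 2 * x ^ 6 =
      (x * (22 * x ^ 2 + 5 * x - 2)) * (1 + x) ^ 3 - 2 * (5 * x ^ 4 * (2 * x ^ 2 + 7 * x + 11))"
    by (simp add: algebra_simps eval_nat_numeral)
  then show ?thesis
    using assms by (simp only: split power_eq_0_iff simp_thms)
qed

theorem proposition3p7:
  fixes M :: "int \<Rightarrow> int \<Rightarrow> (rat poly, 'u, 'p) pairs_space"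
    and Z Z_ge4 q :: "rat fls"
  defines "q \<equiv> fls_X"
    and "Z \<equiv> PT_series M 5 \<one>\<^bsub>coh_P3\<^esub> line_class"
    and "Z_ge4 \<equiv> PT_series_ge 4 M 5 \<one>\<^bsub>coh_P3\<^esub> line_class"
  assumes theory_P3: "stable_pairs_theory coh_P3 M"
    and Pandharipande:
      "Z = (- 2 * q - q ^ 2 + 31 * q ^ 3 - 31 * q ^ 4 + q ^ 5 + 2 * q ^ 6) / (18 * (1 + q) ^ 3)"
  shows "Z_ge4 = - (5 * q ^ 4 * (2 * q ^ 2 + 7 * q + 11) / (9 * (1 + q) ^ 3))
    \<and> Z - Z_ge4 = q * (22 * q ^ 2 + 5 * q - 2) / 18
    \<and> is_Laurent_polynomial (Z - Z_ge4)"
proof -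
  define R where "R = q * (22 * q ^ 2 + 5 * q - 2) / 18"
  define T where "T = - (5 * q ^ 4 * (2 * q ^ 2 + 7 * q + 11) / (9 * (1 + q) ^ 3))"
  define h :: "rat fps" where "h = 9 * (1 + fps_X) ^ 3"
  define f :: "rat fps" where "f = 5 * (2 * fps_X ^ 2 + 7 * fps_X + 11)"

  have q: "q = fps_to_fls fps_X"
    by (simp add: q_def)
  have "fls_nth (1 + q) 0 \<noteq> 0"
    by (simp add: q_def)
  then have unit: "1 + q \<noteq> 0"
    by (metis fls_zero_nth)

  have "Z = R + T"
    unfolding Pandharipande R_def T_def using unit by (rule line_series_decomposition)

  have "fps_nth h 0 \<noteq> 0"
    by (simp add: h_def fps_nth_power_0)
  then have "inverse (fps_to_fls h) = fps_to_fls (inverse h)"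
    by (intro fls_inverse_fps_to_fls) simp
  moreover have "fps_to_fls h = 9 * (1 + q) ^ 3"
    by (simp add: h_def q fls_times_fps_to_fls fps_to_fls_power)
  moreover have "fps_to_fls f = 5 * (2 * q ^ 2 + 7 * q + 11)"
    by (simp add: f_def q fls_times_fps_to_fls fps_to_fls_power)
  moreover have "T = q ^ 4 * - ((5 * (2 * q ^ 2 + 7 * q + 11)) * inverse (9 * (1 + q) ^ 3))"
    by (simp only: T_def divide_inverse mult_minus_right mult.assoc mult.left_commute)
  ultimately have "T = q ^ 4 * fps_to_fls (- (f * inverse h))"
    by (simp only: fls_times_fps_to_fls fps_to_fls_uminus)
  then have T_nth: "fls_nth T n = 0" if "n < 4" for n
    using that by (simp add: q_def fls_X_power_times_conv_shift)

  have "18 * R = q * (22 * q ^ 2 + 5 * q - 2)"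
    by (simp add: R_def)
  also have "\<dots> = 22 * q ^ 3 + 5 * q ^ 2 - 2 * q"
    by (simp add: algebra_simps power2_eq_square power3_eq_cube)
  finally have "18 * R = 22 * q ^ 3 + 5 * q ^ 2 - 2 * q" .
  then have R_nth_18: "18 * fls_nth R n = fls_nth (22 * q ^ 3 + 5 * q ^ 2 - 2 * q) n" for n
    by (metis fls_mult_of_numeral_nth(1))
  have R_nth: "fls_nth R n = 0" if "n \<notin> {1, 2, 3}" for n
    using R_nth_18[of n] that by (simp add: q_def)
  then have "{n. fls_nth R n \<noteq> 0} \<subseteq> {1, 2, 3}"
    by blast
  then have R_Laurent: "is_Laurent_polynomial R"
    unfolding is_Laurent_polynomial_def by (rule finite_subset) simp

  have "\<one>\<^bsub>coh_P3\<^esub> \<in> carrier coh_P3"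
    by (simp add: coh_P3_def)
  then have "Z_ge4 = T"
    unfolding Z_ge4_def
  proof (rule stable_pairs_theory.PT_series_ge_eqI[OF theory_P3])
    show "PT_series M 5 \<one>\<^bsub>coh_P3\<^esub> line_class = R + T"
      using \<open>Z = R + T\<close> by (simp only: Z_def)
    show "fls_nth R n = 0" if "n \<ge> 4" for n
      using that by (intro R_nth) auto
  qed (rule T_nth)
  then show ?thesis
    using \<open>Z = R + T\<close> R_Laurent by (simp flip: R_def T_def)
qed

end
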